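(* Let $G$ be a graph on $n$ vertices. Then $$\mathrm{capt}_b(G)\leq\frac{(2n)^{c_b(G)+2}}{c_b(G)!}.$$
   Context: Bridge-burning cops and robbers is played on a finite graph $G$. First the cops choose their starting vertices, then the robber, knowing these, chooses his. Then cops and robber alternate turns, cops first; on the cops' turn each cop moves to an adjacent vertex or stays put, and on the robber's turn he moves to an adjacent vertex or stays put. Whenever the robber moves from a vertex $u$ to a vertex $v$, the edge $uv$ is erased from the graph (for both players, for the rest of the game). A round is a cop turn followed by the subsequent robber turn. The cops win (capture the robber) if some cop and the robber ever occupy the same vertex; the robber wins if he avoids capture forever. All positions are visible to both sides. The bridge-burning cop number $c_b(G)$ is the minimum number of cops that can guarantee capture on $G$. The bridge-burning capture time $\mathrm{capt}_b(G)$ is the minimum number of rounds within which $c_b(G)$ cops can guarantee capture on $G$ (the cops minimising and the robber maximising the length of the game). *)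

theory Defs
  imports Complex_Main "Graph_Theory.Pair_Digraph"
begin

text \<open>
  A finite simple graph is a \<open>pair_graph\<close>: a finite vertex set with a symmetric, irreflexive
  set of arcs, the edge \<open>uv\<close> being the pair of arcs \<open>(u, v)\<close> and \<open>(v, u)\<close>.

  The robber's side of a play is the sequence \<open>r 0, r 1, \<dots>\<close> of his positions, where \<open>r 0\<close> is his
  starting vertex and \<open>r i\<close> his position after round \<open>i\<close>. Plays are infinite; a game that has ended
  by capture is continued arbitrarily, which affects neither whether nor when capture occurs.
\<close>

definition burnt :: "(nat \<Rightarrow> 'a) \<Rightarrow> nat \<Rightarrow> 'a rel" where
  "burnt r i = (\<Union>j<i. {(r j, r (Suc j)), (r (Suc j), r j)})"

definition remaining :: "'a pair_pre_digraph \<Rightarrow> (nat \<Rightarrow> 'a) \<Rightarrow> nat \<Rightarrow> 'a pair_pre_digraph" where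
  "remaining G r i = G\<lparr>parcs := parcs G - burnt r i\<rparr>"

definition may_move :: "'a pair_pre_digraph \<Rightarrow> 'a \<Rightarrow> 'a \<Rightarrow> bool" where
  "may_move H u v \<longleftrightarrow> v = u \<or> (u, v) \<in> parcs H"

definition robber_play :: "'a pair_pre_digraph \<Rightarrow> (nat \<Rightarrow> 'a) \<Rightarrow> bool" where
  "robber_play G r \<longleftrightarrow>
     r 0 \<in> pverts G \<and> (\<forall>i. may_move (remaining G r i) (r i) (r (Suc i)))"

text \<open>
  A strategy for \<open>k\<close> cops maps the history \<open>[r 0, \<dots>, r (i - 1)]\<close> of robber positions to the
  position of each cop \<open>c < k\<close> after the cops' turn of round \<open>i\<close>; the empty history gives the
  starting vertices, chosen before the robber's. The history need not record the cops' own
  positions, since the strategy and the robber's positions determine them. Since such a strategy is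
  deterministic and never sees the future, quantifying over all robber plays after fixing the
  strategy covers all robbers who react to the cops' positions.
\<close>

type_synonym 'a cop_strategy = "'a list \<Rightarrow> nat \<Rightarrow> 'a"

definition cops_at :: "'a cop_strategy \<Rightarrow> (nat \<Rightarrow> 'a) \<Rightarrow> nat \<Rightarrow> nat \<Rightarrow> 'a" where
  "cops_at \<sigma> r i = \<sigma> (map r [0..<i])"

definition legal_strategy :: "'a pair_pre_digraph \<Rightarrow> nat \<Rightarrow> 'a cop_strategy \<Rightarrow> bool" where
  "legal_strategy G k \<sigma> \<longleftrightarrow>
     (\<forall>c<k. \<sigma> [] c \<in> pverts G) \<and>
     (\<forall>r. robber_play G r \<longrightarrow>
        (\<forall>i. \<forall>c<k. may_move (remaining G r i) (cops_at \<sigma> r i c) (cops_at \<sigma> r (Suc i) c)))"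

text \<open>
  Capture occurs when the robber chooses his starting vertex, or in some round \<open>Suc i\<close>: either on
  the cops' turn, the robber still being at \<open>r i\<close>, or on the robber's turn.
\<close>

definition captured_within ::
    "nat \<Rightarrow> 'a cop_strategy \<Rightarrow> (nat \<Rightarrow> 'a) \<Rightarrow> nat \<Rightarrow> bool" where
  "captured_within k \<sigma> r t \<longleftrightarrow>
     (\<exists>c<k. cops_at \<sigma> r 0 c = r 0) \<or>
     (\<exists>i<t. \<exists>c<k. cops_at \<sigma> r (Suc i) c = r i \<or> cops_at \<sigma> r (Suc i) c = r (Suc i))"

definition cops_can_win :: "'a pair_pre_digraph \<Rightarrow> nat \<Rightarrow> bool" where
  "cops_can_win G k \<longleftrightarrow>
     (\<exists>\<sigma>. legal_strategy G k \<sigma> \<and> (\<forall>r. robber_play G r \<longrightarrow> (\<exists>t. captured_within k \<sigma> r t)))"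

definition cops_can_win_within :: "'a pair_pre_digraph \<Rightarrow> nat \<Rightarrow> nat \<Rightarrow> bool" where
  "cops_can_win_within G k t \<longleftrightarrow>
     (\<exists>\<sigma>. legal_strategy G k \<sigma> \<and> (\<forall>r. robber_play G r \<longrightarrow> captured_within k \<sigma> r t))"

definition bb_cop_number :: "'a pair_pre_digraph \<Rightarrow> nat" where
  "bb_cop_number G = (LEAST k. cops_can_win G k)"

definition bb_capture_time :: "'a pair_pre_digraph \<Rightarrow> nat" where
  "bb_capture_time G = (LEAST t. cops_can_win_within G (bb_cop_number G) t)"

end

theory Submission
  imports Defs "HOL-Combinatorics.Permutations"
begin

text \<open>
  Let \<open>k\<close> cops play on \<open>n\<close> vertices. Fix a surviving graph and a robber
  position, and let \<open>M\<close> bound the capture times of all winning positions with fewer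
  edges. From a position of capture time \<open>s + 1 > M + 1\<close> the cops can move so that a
  robber who stays put is in a position of capture time exactly \<open>s\<close>, as after any other
  robber move an edge is gone, so at most \<open>M < s\<close> further rounds are needed. Hence all
  capture times above \<open>M\<close> up to the maximal one are attained at this graph and robber
  position. Capture time depends only on the multiset of cop positions, so at most \<open>N =
  binomial(n + k - 1, k)\<close> of these values exist, and induction on the number \<open>a\<close>
  of arcs bounds the capture time by \<open>(a + 1) N \<le> (n\<^sup>2 + 1) N\<close>. As
  \<open>n\<close> cops always win, the cop number \<open>k\<close> is at most \<open>n\<close>,
  whence \<open>N \<le> (2 n)\<^sup>k / k!\<close>.
\<close>

section \<open>Positions of the game and winning within a given number of rounds\<close>

definition burn :: "'a pair_pre_digraph \<Rightarrow> 'a \<Rightarrow> 'a \<Rightarrow> 'a pair_pre_digraph" where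
  "burn H u v = H\<lparr>parcs := parcs H - {(u, v), (v, u)}\<rparr>"

definition cops_may_move ::
    "nat \<Rightarrow> 'a pair_pre_digraph \<Rightarrow> (nat \<Rightarrow> 'a) \<Rightarrow> (nat \<Rightarrow> 'a) \<Rightarrow> bool" where
  "cops_may_move k H C C' \<longleftrightarrow> (\<forall>c<k. may_move H (C c) (C' c))"

text \<open>The cops are to move with at most \<open>t\<close> rounds left, and \<open>H\<close>
  stands for the history. A robber who steps onto a cop is caught by the first disjunct at the next
  position.\<close>

fun wins :: "nat \<Rightarrow> nat \<Rightarrow> 'a pair_pre_digraph \<Rightarrow> (nat \<Rightarrow> 'a) \<Rightarrow> 'a \<Rightarrow> bool" where
  "wins k 0 H C v \<longleftrightarrow> v \<in> C ` {..<k}"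
| "wins k (Suc t) H C v \<longleftrightarrow> v \<in> C ` {..<k} \<or>
     (\<exists>C'. cops_may_move k H C C' \<and>
        (v \<in> C' ` {..<k} \<or> (\<forall>v'. may_move H v v' \<longrightarrow> wins k t (burn H v v') C' v')))"

declare wins.simps(2) [simp del]

lemma parcs_burn [simp]: "parcs (burn H u v) = parcs H - {(u, v), (v, u)}"
  by (simp add: burn_def)

lemma burn_refl: "(u, u) \<notin> parcs H \<Longrightarrow> burn H u u = H"
  by (simp add: burn_def)

lemma remaining_0 [simp]: "remaining G r 0 = G"
  by (simp add: remaining_def burnt_def)

lemma remaining_Suc: "remaining G r (Suc i) = burn (remaining G r i) (r i) (r (Suc i))"
proof -
  have "parcs G - burnt r (Suc i) = parcs G - burnt r i - {(r i, r (Suc i)), (r (Suc i), r i)}"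
    by (auto simp: burnt_def less_Suc_eq)
  then show ?thesis
    by (simp add: remaining_def burn_def)
qed

lemma remaining_cong:
  assumes "\<And>j. j \<le> i \<Longrightarrow> r j = r' j"
  shows "remaining G r i = remaining G r' i"
proof -
  have "burnt r i = burnt r' i"
    using assms by (auto simp: burnt_def)
  then show ?thesis
    by (simp add: remaining_def)
qed

lemma wins_if_caught: "v \<in> C ` {..<k} \<Longrightarrow> wins k t H C v"
  by (cases t) (auto simp: wins.simps(2))

lemma wins_Suc: "wins k t H C v \<Longrightarrow> wins k (Suc t) H C v"
proof (induction t arbitrary: H C v)
  case (Suc t)
  then show ?case
    unfolding wins.simps(2)[of k "Suc t"] using Suc.prems[unfolded wins.simps(2)] by blast
qed (simp add: wins.simps(2))

lemma wins_mono: "s \<le> t \<Longrightarrow> wins k s H C v \<Longrightarrow> wins k t H C v"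
  by (induction rule: dec_induct) (auto intro: wins_Suc)

section \<open>Interchangeability of the cops\<close>

lemma wins_permute:
  assumes "p permutes {..<k}" and "wins k t H C v"
  shows "wins k t H (C \<circ> p) v"
  using assms(2)
proof (induction t arbitrary: H C v)
  case 0
  then show ?case
    using permutes_image[OF assms(1)] by (simp only: wins.simps image_comp[symmetric])
next
  case (Suc t)
  have img: "(D \<circ> p) ` {..<k} = D ` {..<k}" for D :: "nat \<Rightarrow> 'a"
    using permutes_image[OF assms(1)] by (simp only: image_comp[symmetric])
  \<comment> \<open>A permuted position is answered by the same permutation of the winning
    move.\<close>
  have mv: "cops_may_move k H (C \<circ> p) (C' \<circ> p)" if "cops_may_move k H C C'" for C'
    using that permutes_in_image[OF assms(1)] by (auto simp: cops_may_move_def)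
  show ?case
  proof (cases "v \<in> C ` {..<k}")
    case True
    then show ?thesis
      using wins_if_caught img by metis
  next
    case False
    then obtain C' where "cops_may_move k H C C'"
      and "v \<in> C' ` {..<k} \<or> (\<forall>v'. may_move H v v' \<longrightarrow> wins k t (burn H v v') C' v')"
      using Suc.prems by (auto simp: wins.simps(2))
    then have "cops_may_move k H (C \<circ> p) (C' \<circ> p)"
      and "v \<in> (C' \<circ> p) ` {..<k} \<or>
           (\<forall>v'. may_move H v v' \<longrightarrow> wins k t (burn H v v') (C' \<circ> p) v')"
      using mv Suc.IH unfolding img by blast+
    then show ?thesis
      unfolding wins.simps(2) by blast
  qed
qed

lemma wins_cong:
  assumes "\<And>c. c < k \<Longrightarrow> C c = D c"
  shows "wins k t H C v \<longleftrightarrow> wins k t H D v"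
proof -
  have "C ` {..<k} = D ` {..<k}"
    using assms by auto
  moreover have "cops_may_move k H C = cops_may_move k H D"
    using assms by (auto simp: cops_may_move_def fun_eq_iff)
  ultimately show ?thesis
    by (cases t) (simp_all add: wins.simps(2))
qed

text \<open>Forgetting which cop stands where is the source of the factorial in the denominator of
  the final bound.\<close>

definition cop_mset :: "nat \<Rightarrow> (nat \<Rightarrow> 'a) \<Rightarrow> 'a multiset" where
  "cop_mset k C = mset (map C [0..<k])"

lemma wins_cop_mset:
  assumes "cop_mset k C = cop_mset k D" and "wins k t H D v"
  shows "wins k t H C v"
proof -
  obtain p where p: "p permutes {..<length (map D [0..<k])}"
    and eq: "permute_list p (map D [0..<k]) = map C [0..<k]"
    using mset_eq_permutation assms(1) unfolding cop_mset_def by metis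
  have "C c = (D \<circ> p) c" if "c < k" for c
    using arg_cong[OF eq, of "\<lambda>xs. xs ! c"] that p permutes_in_image[OF p, of c]
    by (simp add: permute_list_nth)
  then show ?thesis
    using wins_cong wins_permute p assms(2) by (metis length_map length_upt minus_nat.diff_0)
qed

section \<open>Bounding the capture time by induction on the number of arcs\<close>

lemma cop_mset_in:
  assumes "C ` {..<k} \<subseteq> V"
  shows "cop_mset k C \<in> multisets_of_size V k"
  using assms by (auto simp: cop_mset_def multisets_of_size_def)

lemma cops_may_move_image:
  assumes "cops_may_move k H C C'" and "C ` {..<k} \<subseteq> V" and "parcs H \<subseteq> V \<times> V"
  shows "C' ` {..<k} \<subseteq> V"
  using assms by (fastforce simp: cops_may_move_def may_move_def)

text \<open>A robber who stays put burns nothing. If he then lost within \<open>s - 1\<close>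
  rounds, so would every robber who burns an edge, because \<open>M \<le> s - 1\<close>; the cops
  would win from \<open>C\<close> within \<open>s\<close> rounds.\<close>

lemma wins_descend:
  assumes irr: "\<And>x. (x, x) \<notin> parcs H"
    and M: "\<And>C' v'. (v, v') \<in> parcs H \<Longrightarrow> C' ` {..<k} \<subseteq> V \<Longrightarrow>
              \<exists>t. wins k t (burn H v v') C' v' \<Longrightarrow> wins k M (burn H v v') C' v'"
    and arcs: "parcs H \<subseteq> V \<times> V" and C: "C ` {..<k} \<subseteq> V"
    and s: "M < s" and win: "wins k (Suc s) H C v" and nwin: "\<not> wins k s H C v"
  shows "\<exists>C'. C' ` {..<k} \<subseteq> V \<and> wins k s H C' v \<and> \<not> wins k (s - 1) H C' v"
proof -
  obtain s' where s': "s = Suc s'" "M \<le> s'"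
    using s by (cases s) auto
  \<comment> \<open>As \<open>s\<close> is positive, a capture by the end of the cops' turn would be
    a win within \<open>s\<close> rounds, so the winning move leaves the robber uncaught.\<close>
  obtain C' where mv: "cops_may_move k H C C'" and notin: "v \<notin> C' ` {..<k}"
    and w: "\<And>v'. may_move H v v' \<Longrightarrow> wins k s (burn H v v') C' v'"
    using win nwin wins_if_caught[of v C k s] unfolding wins.simps(2)[of k s]
    by (metis s'(1) wins.simps(2))
  have C': "C' ` {..<k} \<subseteq> V"
    using cops_may_move_image[OF mv C arcs] .
  have "wins k s H C' v"
    using w[of v] burn_refl[OF irr] by (simp add: may_move_def)
  moreover have "\<not> wins k s' H C' v"
  proof
    assume stay: "wins k s' H C' v"
    have "wins k s' (burn H v v') C' v'" if "may_move H v v'" for v'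
    proof (cases "v' = v")
      case True
      then show ?thesis
        using stay burn_refl[OF irr] by metis
    next
      case False
      then have "(v, v') \<in> parcs H"
        using that by (simp add: may_move_def)
      then have "wins k M (burn H v v') C' v'"
        using w[OF that] by (intro M C' exI)
      then show ?thesis
        by (rule wins_mono[OF s'(2)])
    qed
    then show False
      using mv nwin s'(1) by (auto simp: wins.simps(2))
  qed
  ultimately show ?thesis
    using C' s'(1) by auto
qed

lemma wins_bound:
  assumes "finite V" and "parcs H \<subseteq> V \<times> V" and "\<And>x. (x, x) \<notin> parcs H"
    and "C ` {..<k} \<subseteq> V" and "\<exists>t. wins k t H C v"
  shows "wins k ((card (parcs H) + 1) * card (multisets_of_size V k)) H C v"
  using assms(2-)
proof (induction "card (parcs H)" arbitrary: H C v rule: less_induct)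
  case less
  let ?N = "card (multisets_of_size V k)"
  \<comment> \<open>The claimed bound for one arc fewer.\<close>
  define M where "M = card (parcs H) * ?N"
  have finH: "finite (parcs H)"
    using finite_subset[OF less.prems(1)] assms(1) by simp
  have M: "wins k M (burn H v v') C' v'"
    if "(v, v') \<in> parcs H" "C' ` {..<k} \<subseteq> V" "\<exists>t. wins k t (burn H v v') C' v'" for C' v'
  proof -
    have lt: "card (parcs (burn H v v')) < card (parcs H)"
      using that(1) finH by (intro psubset_card_mono) auto
    have "wins k ((card (parcs (burn H v v')) + 1) * ?N) (burn H v v') C' v'"
      by (rule less.hyps[OF lt]) (use less.prems that in auto)
    moreover have "(card (parcs (burn H v v')) + 1) * ?N \<le> M"
      unfolding M_def using lt by (intro mult_right_mono) auto
    ultimately show ?thesis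
      by (rule wins_mono[rotated])
  qed
  define T where "T = (LEAST t. wins k t H C v)"
  have T: "wins k T H C v"
    unfolding T_def using less.prems(4) by (rule LeastI_ex)
  have nT: "\<not> wins k t H C v" if "t < T" for t
    using not_less_Least that unfolding T_def by blast
  \<comment> \<open>Descending from \<open>T\<close>, attained by \<open>C\<close> itself: every
    value in \<open>{M<..T}\<close> is the exact capture time of some cop position, with
    \<open>H\<close> and \<open>v\<close> fixed.\<close>
  have rank: "\<exists>D. D ` {..<k} \<subseteq> V \<and> wins k s H D v \<and> \<not> wins k (s - 1) H D v"
    if "M < s" "s \<le> T" for s
    using that(2,1)
  proof (induction rule: inc_induct)
    case base
    then show ?case
      using T nT[of "T - 1"] less.prems(3) by auto
  next
    case (step s)
    then obtain D where "D ` {..<k} \<subseteq> V" "wins k (Suc s) H D v" "\<not> wins k s H D v"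
      by auto
    then show ?case
      using wins_descend[where M = M and V = V and H = H and v = v and s = s and C = D and k = k]
        M less.prems(1,2) step.prems by auto
  qed
  obtain D where D: "\<And>s. s \<in> {M<..T} \<Longrightarrow>
      D s ` {..<k} \<subseteq> V \<and> wins k s H (D s) v \<and> \<not> wins k (s - 1) H (D s) v"
    using rank by (metis greaterThanAtMost_iff)
  \<comment> \<open>Equal multisets would carry the win within \<open>s \<le> s' - 1\<close> rounds
    over to \<open>D s'\<close>, whose exact time is \<open>s'\<close>.\<close>
  have "cop_mset k (D s) \<noteq> cop_mset k (D s')" if "s \<in> {M<..T}" "s' \<in> {M<..T}" "s < s'" for s s'
  proof
    assume "cop_mset k (D s) = cop_mset k (D s')"
    then have "wins k s H (D s') v"
      using wins_cop_mset D[OF that(1)] by metis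
    then have "wins k (s' - 1) H (D s') v"
      by (rule wins_mono[rotated]) (use that(3) in simp)
    then show False
      using D[OF that(2)] by blast
  qed
  then have "inj_on (\<lambda>s. cop_mset k (D s)) {M<..T}"
    by (intro linorder_inj_onI') auto
  moreover have "(\<lambda>s. cop_mset k (D s)) ` {M<..T} \<subseteq> multisets_of_size V k"
    by (rule image_subsetI, rule cop_mset_in, rule conjunct1[OF D])
  ultimately have "card {M<..T} \<le> ?N"
    by (rule card_inj_on_le[OF _ _ finite_multisets_of_size[OF assms(1)]])
  then have "T \<le> (card (parcs H) + 1) * ?N"
    by (simp add: M_def)
  then show ?case
    using T by (rule wins_mono)
qed

section \<open>From winning positions to cop strategies\<close>

definition winning_move ::
    "nat \<Rightarrow> nat \<Rightarrow> 'a pair_pre_digraph \<Rightarrow> (nat \<Rightarrow> 'a) \<Rightarrow> 'a \<Rightarrow> (nat \<Rightarrow> 'a) \<Rightarrow> bool" where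
  "winning_move k t H C v C' \<longleftrightarrow> cops_may_move k H C C' \<and>
     (v \<in> C' ` {..<k} \<or> (\<forall>v'. may_move H v v' \<longrightarrow> wins k t (burn H v v') C' v'))"

text \<open>The default of staying put keeps the cops' moves legal in every position.\<close>

definition next_cops ::
    "nat \<Rightarrow> nat \<Rightarrow> 'a pair_pre_digraph \<Rightarrow> (nat \<Rightarrow> 'a) \<Rightarrow> 'a \<Rightarrow> nat \<Rightarrow> 'a" where
  "next_cops k t H C v =
     (if \<exists>C'. winning_move k t H C v C' then SOME C'. winning_move k t H C v C' else C)"

lemma winning_move_next_cops:
  "winning_move k t H C v C' \<Longrightarrow> winning_move k t H C v (next_cops k t H C v)"
  unfolding next_cops_def by (simp add: exI someI[of "winning_move k t H C v"])

lemma next_cops_legal: "cops_may_move k H C (next_cops k t H C v)"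
proof (cases "\<exists>C'. winning_move k t H C v C'")
  case True
  then have "winning_move k t H C v (next_cops k t H C v)"
    by (elim exE winning_move_next_cops)
  then show ?thesis
    unfolding winning_move_def by blast
next
  case False
  then show ?thesis
    by (simp add: next_cops_def cops_may_move_def may_move_def)
qed

lemma next_cops_wins:
  assumes "wins k (Suc t) H C v" and "v \<notin> C ` {..<k}"
    and "v \<notin> next_cops k t H C v ` {..<k}" and "may_move H v v'"
  shows "wins k t (burn H v v') (next_cops k t H C v) v'"
proof -
  have "\<exists>C'. winning_move k t H C v C'"
    using assms(1,2) unfolding wins.simps(2) winning_move_def by blast
  then have "winning_move k t H C v (next_cops k t H C v)"
    by (elim exE winning_move_next_cops)
  then show ?thesis
    using assms(3,4) unfolding winning_move_def by blast
qed

text \<open>After round \<open>Suc i\<close> there remain \<open>T - Suc i\<close> rounds; past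
  round \<open>T\<close> the truncated difference is 0.\<close>

primrec cop_play ::
    "nat \<Rightarrow> nat \<Rightarrow> 'a pair_pre_digraph \<Rightarrow> (nat \<Rightarrow> 'a) \<Rightarrow> (nat \<Rightarrow> 'a) \<Rightarrow> nat \<Rightarrow> nat \<Rightarrow> 'a" where
  "cop_play k T G C r 0 = C"
| "cop_play k T G C r (Suc i) =
     next_cops k (T - Suc i) (remaining G r i) (cop_play k T G C r i) (r i)"

text \<open>The cops never look ahead, so their play can be read as a function of the history
  list.\<close>

lemma cop_play_cong:
  assumes "\<And>j. j < i \<Longrightarrow> r j = r' j"
  shows "cop_play k T G C r i = cop_play k T G C r' i"
  using assms
proof (induction i)
  case (Suc i)
  then show ?case
    using remaining_cong[of i r r' G] by simp
qed simp

lemma cops_can_win_within_if_wins: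
  assumes C: "C ` {..<k} \<subseteq> pverts G" and win: "\<And>v. v \<in> pverts G \<Longrightarrow> wins k T G C v"
  shows "cops_can_win_within G k T"
proof -
  define \<sigma> where "\<sigma> h = cop_play k T G C ((!) h) (length h)" for h
  have at: "cops_at \<sigma> r i = cop_play k T G C r i" for r i
    unfolding cops_at_def \<sigma>_def using cop_play_cong[of i "(!) (map r [0..<i])" r] by simp
  have "legal_strategy G k \<sigma>"
    unfolding legal_strategy_def at
  proof (intro conjI allI impI)
    show "\<sigma> [] c \<in> pverts G" if "c < k" for c
      using that C by (auto simp: \<sigma>_def)
    show "may_move (remaining G r i) (cop_play k T G C r i c) (cop_play k T G C r (Suc i) c)"
      if "c < k" for r i c
      using that by (simp add: next_cops_legal[unfolded cops_may_move_def, rule_format])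
  qed
  moreover have "captured_within k \<sigma> r T" if r: "robber_play G r" for r
  proof (rule ccontr)
    assume nc: "\<not> captured_within k \<sigma> r T"
    let ?C = "cop_play k T G C r"
    have nc0: "r 0 \<notin> ?C 0 ` {..<k}"
      and nc1: "i < T \<Longrightarrow> r i \<notin> ?C (Suc i) ` {..<k}"
      and nc2: "i < T \<Longrightarrow> r (Suc i) \<notin> ?C (Suc i) ` {..<k}" for i
      using nc unfolding captured_within_def at by (metis imageE lessThan_iff)+
    have ncur: "r i \<notin> ?C i ` {..<k}" if "i \<le> T" for i
      using that nc0 nc2 by (cases i) (auto simp del: cop_play.simps)
    \<comment> \<open>Invariant of an uncaught play; at \<open>i = T\<close> no rounds are left, so
      the robber is already caught.\<close>
    have "wins k (T - i) (remaining G r i) (?C i) (r i)" if "i \<le> T" for i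
      using that
    proof (induction i)
      case 0
      then show ?case
        using r win by (simp add: robber_play_def)
    next
      case (Suc i)
      then have "wins k (Suc (T - Suc i)) (remaining G r i) (?C i) (r i)"
        by (metis Suc_diff_Suc Suc_le_lessD Suc_leD)
      moreover have "may_move (remaining G r i) (r i) (r (Suc i))"
        using r by (simp add: robber_play_def)
      ultimately show ?case
        unfolding remaining_Suc cop_play.simps
        using next_cops_wins ncur[of i] nc1[of i] Suc.prems by (metis Suc_leD Suc_le_lessD cop_play.simps(2))
    qed
    from this[of T] show False
      using ncur[of T] by simp
  qed
  ultimately show ?thesis
    unfolding cops_can_win_within_def by blast
qed

section \<open>From cop strategies to winning positions\<close>

lemma evasive_move:
  assumes fin: "finite (parcs H)" and lose: "\<And>t. \<not> wins k t H C v"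
    and mv: "cops_may_move k H C C'"
  shows "v \<notin> C' ` {..<k}" and "\<exists>v'. may_move H v v' \<and> (\<forall>t. \<not> wins k t (burn H v v') C' v')"
proof -
  show "v \<notin> C' ` {..<k}"
    using lose[of 1] mv by (auto simp: wins.simps(2))
  show "\<exists>v'. may_move H v v' \<and> (\<forall>t. \<not> wins k t (burn H v v') C' v')"
  proof (rule ccontr)
    assume "\<not> ?thesis"
    then obtain f where f: "\<And>v'. may_move H v v' \<Longrightarrow> wins k (f v') (burn H v v') C' v'"
      by metis
    have "{v'. may_move H v v'} \<subseteq> insert v (snd ` parcs H)"
      by (force simp: may_move_def)
    then have "finite {v'. may_move H v v'}"
      using fin finite_subset by blast
    \<comment> \<open>The robber has finitely many answers, so one number of rounds serves for all
      of them.\<close>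
    then have "wins k (Max (f ` {v'. may_move H v v'})) (burn H v v') C' v'" if "may_move H v v'" for v'
      using that f by (intro wins_mono[OF _ f[OF that]]) auto
    then show False
      using lose[of "Suc (Max (f ` {v'. may_move H v v'}))"] mv by (auto simp: wins.simps(2))
  qed
qed

text \<open>Otherwise the robber starts at \<open>v\<close> and keeps the position unwinnable for
  every number of rounds, escaping \<open>\<sigma>\<close> forever. Thus eventual capture in every
  play gives a bound on the rounds.\<close>

lemma wins_if_cops_can_win:
  assumes fin: "finite (parcs G)" and leg: "legal_strategy G k \<sigma>"
    and win: "\<And>r. robber_play G r \<Longrightarrow> \<exists>t. captured_within k \<sigma> r t"
    and v: "v \<in> pverts G"
  shows "\<exists>t. wins k t G (\<sigma> []) v"
proof (rule ccontr)
  assume lose: "\<not> ?thesis"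
  \<comment> \<open>With \<open>h = [r 0, ..., r i]\<close>, the cops have just moved to
    \<open>\<sigma> h\<close> in round \<open>Suc i\<close>, and \<open>i\<close> moves of the
    robber are burnt.\<close>
  define evade where "evade h v' \<longleftrightarrow> (let i = length h - 1; H = remaining G ((!) h) i in
      may_move H (last h) v' \<and> (\<forall>t. \<not> wins k t (burn H (last h) v') (\<sigma> h) v'))" for h v'
  \<comment> \<open>The default makes \<open>r\<close> a robber play before an evasive move is known
    to exist; legality of \<open>\<sigma>\<close>, from which that existence follows, is given only
    along robber plays.\<close>
  define pick where "pick h = (if \<exists>v'. evade h v' then SOME v'. evade h v' else last h)" for h
  define hist where "hist = rec_nat [v] (\<lambda>_ h. h @ [pick h])"
  define r where "r i = last (hist i)" for i
  have hist: "hist i = map r [0..<Suc i]" for i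
    by (induction i) (auto simp: hist_def r_def)
  have last: "last (hist i) = r i" and len: "length (hist i) - 1 = i" for i
    by (simp_all add: hist)
  have rem: "remaining G ((!) (hist i)) i = remaining G r i" for i
    by (rule remaining_cong) (auto simp: hist simp del: upt_Suc)
  have evade: "evade (hist i) v' \<longleftrightarrow> may_move (remaining G r i) (r i) v' \<and>
      (\<forall>t. \<not> wins k t (burn (remaining G r i) (r i) v') (cops_at \<sigma> r (Suc i)) v')" for i v'
  proof -
    have "\<sigma> (hist i) = cops_at \<sigma> r (Suc i)"
      by (simp only: cops_at_def hist)
    then show ?thesis
      by (simp only: evade_def Let_def last len rem)
  qed
  have r_Suc: "r (Suc i) = pick (hist i)" for i
    by (simp add: r_def hist_def)
  have mv: "may_move (remaining G r i) (r i) (r (Suc i))" for i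
  proof (cases "\<exists>v'. evade (hist i) v'")
    case True
    then have "evade (hist i) (r (Suc i))"
      unfolding r_Suc pick_def by (simp add: someI_ex)
    then show ?thesis
      unfolding evade by blast
  next
    case False
    then show ?thesis
      by (simp add: r_Suc pick_def last may_move_def)
  qed
  have play: "robber_play G r"
    using mv v by (simp add: robber_play_def r_def hist_def)
  have inv: "\<not> wins k t (remaining G r i) (cops_at \<sigma> r i) (r i)" for i t
  proof (induction i arbitrary: t)
    case 0
    then show ?case
      using lose by (simp add: cops_at_def r_def hist_def)
  next
    case (Suc i)
    have "cops_may_move k (remaining G r i) (cops_at \<sigma> r i) (cops_at \<sigma> r (Suc i))"
      using leg play by (simp add: legal_strategy_def cops_may_move_def)
    moreover have "finite (parcs (remaining G r i))"
      using fin by (simp add: remaining_def)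
    ultimately have "\<exists>v'. evade (hist i) v'"
      unfolding evade using evasive_move(2)[OF _ Suc.IH] by blast
    then have "evade (hist i) (r (Suc i))"
      unfolding r_Suc pick_def by (simp add: someI_ex)
    then show ?case
      unfolding evade remaining_Suc by blast
  qed
  have "\<not> captured_within k \<sigma> r t" for t
  proof -
    \<comment> \<open>Being caught is winning within 0 rounds, which the invariant excludes.\<close>
    have "cops_at \<sigma> r i c \<noteq> r i" if "c < k" for i c
      using inv[of 0 i] that by force
    moreover have "cops_at \<sigma> r (Suc i) c \<noteq> r i" if "c < k" for i c
    proof -
      have "cops_may_move k (remaining G r i) (cops_at \<sigma> r i) (cops_at \<sigma> r (Suc i))"
        using leg play by (simp add: legal_strategy_def cops_may_move_def)
      moreover have "finite (parcs (remaining G r i))"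
        using fin by (simp add: remaining_def)
      ultimately have "r i \<notin> cops_at \<sigma> r (Suc i) ` {..<k}"
        by (intro evasive_move(1)[OF _ inv])
      then show ?thesis
        using that by force
    qed
    ultimately show ?thesis
      by (auto simp: captured_within_def)
  qed
  then show False
    using win[OF play] by blast
qed

section \<open>The bound for the whole game and its numerical form\<close>

lemma cops_can_win_within_bound:
  assumes "pair_graph G" and "cops_can_win G k"
  shows "cops_can_win_within G k
           ((card (parcs G) + 1) * card (multisets_of_size (pverts G) k))"
proof -
  interpret pair_graph G by fact
  obtain \<sigma> where \<sigma>: "legal_strategy G k \<sigma>" "\<And>r. robber_play G r \<Longrightarrow> \<exists>t. captured_within k \<sigma> r t"
    using assms(2) unfolding cops_can_win_def by blast
  have C: "\<sigma> [] ` {..<k} \<subseteq> pverts G"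
    using \<sigma>(1) by (auto simp: legal_strategy_def)
  have arcs: "parcs G \<subseteq> pverts G \<times> pverts G"
    using wellformed' by auto
  have irr: "(x, x) \<notin> parcs G" for x
    using pair_no_loops by fastforce
  show ?thesis
  proof (rule cops_can_win_within_if_wins[OF C])
    fix v assume "v \<in> pverts G"
    then have "\<exists>t. wins k t G (\<sigma> []) v"
      using wins_if_cops_can_win[OF pair_finite_arcs \<sigma>] by blast
    \<comment> \<open>The bound is independent of \<open>v\<close>, so the placement
      \<open>\<sigma> []\<close> serves for every start of the robber.\<close>
    then show "wins k ((card (parcs G) + 1) * card (multisets_of_size (pverts G) k)) G (\<sigma> []) v"
      by (rule wins_bound[OF pair_finite_verts arcs irr C])
  qed
qed

text \<open>A cop on every vertex catches the robber as he chooses his start. Hence the cop number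
  is attained and is at most the number of vertices.\<close>

lemma cops_can_win_card:
  assumes "finite (pverts G)"
  shows "cops_can_win G (card (pverts G))"
proof -
  obtain f where f: "bij_betw f {..<card (pverts G)} (pverts G)"
    using ex_bij_betw_nat_finite[OF assms] by (auto simp: atLeast0LessThan)
  let ?\<sigma> = "\<lambda>_ :: 'a list. f"
  have "legal_strategy G (card (pverts G)) ?\<sigma>"
    using f by (auto simp: legal_strategy_def cops_at_def may_move_def bij_betw_def)
  moreover have "captured_within (card (pverts G)) ?\<sigma> r 0" if "robber_play G r" for r
  proof -
    have "r 0 \<in> f ` {..<card (pverts G)}"
      using that f by (simp add: robber_play_def bij_betw_def)
    then show ?thesis
      by (auto simp: captured_within_def cops_at_def)
  qed
  ultimately show ?thesis
    unfolding cops_can_win_def by blast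
qed

text \<open>Multiplied by \<open>fact k\<close>, the number of multisets is a product of
  \<open>k\<close> factors, each at most \<open>n + k - 1 \<le> 2 * n\<close>.\<close>

lemma choose_multiset_bound:
  fixes n k :: nat
  assumes "k \<le> n"
  shows "real ((n + k - 1) choose k) \<le> (2 * real n) ^ k / fact k"
proof -
  have "((n + k - 1) choose k) * fact k \<le> (n + k - 1) ^ k"
    by (rule binomial_fact_pow)
  also have "\<dots> \<le> (2 * n) ^ k"
    using assms by (intro power_mono) auto
  finally have "real (((n + k - 1) choose k) * fact k) \<le> real ((2 * n) ^ k)"
    by (rule of_nat_mono)
  then show ?thesis
    by (simp add: field_simps)
qed

theorem proposition2p4:
  fixes G :: "'a pair_pre_digraph" and n :: nat
  assumes "pair_graph G"
    and "card (pverts G) = n"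
  shows "real (bb_capture_time G)
           \<le> (2 * real n) ^ (bb_cop_number G + 2) / fact (bb_cop_number G)"
proof -
  interpret pair_graph G by fact
  let ?k = "bb_cop_number G"
  have win_n: "cops_can_win G n"
    using cops_can_win_card[OF pair_finite_verts] assms(2) by simp
  have k: "?k \<le> n" and win: "cops_can_win G ?k"
    unfolding bb_cop_number_def using win_n by (auto intro: Least_le LeastI)
  show ?thesis
  proof (cases "n = 0")
    \<comment> \<open>Without vertices there are no plays, and the later estimate of
      \<open>card (parcs G) + 1\<close> by \<open>(2 * n) ^ 2\<close> would fail.\<close>
    case True
    then have "pverts G = {}"
      using assms(2) pair_finite_verts by simp
    then have "cops_can_win_within G ?k 0"
      using win by (simp add: cops_can_win_within_def cops_can_win_def robber_play_def)
    then have "bb_capture_time G = 0"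
      unfolding bb_capture_time_def by simp
    then show ?thesis
      by simp
  next
    case False
    let ?N = "(n + ?k - 1) choose ?k"
    have arcs: "parcs G \<subseteq> pverts G \<times> pverts G"
      using wellformed' by auto
    then have card_arcs: "card (parcs G) \<le> n * n"
      using card_mono[OF _ arcs] pair_finite_verts assms(2) by (simp add: card_cartesian_product)
    \<comment> \<open>The factor 4 leaves room for the extra 1 once \<open>n\<close> is
      positive.\<close>
    have "(2 * n) ^ 2 = 4 * (n * n)" and "0 < n * n"
      using False by (simp_all add: power2_eq_square)
    then have card_arcs_Suc: "card (parcs G) + 1 \<le> (2 * n) ^ 2"
      using card_arcs by linarith
    have "bb_capture_time G \<le> (card (parcs G) + 1) * card (multisets_of_size (pverts G) ?k)"
      unfolding bb_capture_time_def
      by (intro Least_le cops_can_win_within_bound[OF assms(1) win])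
    also have "card (multisets_of_size (pverts G) ?k) = ?N"
      using card_multisets_of_size[OF pair_finite_verts] assms(2) by simp
    also have "(card (parcs G) + 1) * ?N \<le> (2 * n) ^ 2 * ?N"
      by (rule mult_right_mono[OF card_arcs_Suc]) simp
    finally have "real (bb_capture_time G) \<le> real ((2 * n) ^ 2 * ?N)"
      by (rule of_nat_mono)
    also have "\<dots> = (2 * real n) ^ 2 * real ?N"
      by simp
    also have "\<dots> \<le> (2 * real n) ^ 2 * ((2 * real n) ^ ?k / fact ?k)"
      using k by (intro mult_left_mono choose_multiset_bound) auto
    finally show ?thesis
      by (simp add: power2_eq_square mult_ac)
  qed
qed

end
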